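(* Let $\operatorname{rdasc}(\pi)$ and $\operatorname{lrdasc}(\pi)$ be the number of right double ascents and left-right double ascents of $\pi$, respectively, and let $u=\sqrt{(t+3)(t-1)}$. Then $$\sum_{n\ge0}\sum_{\pi\in\mathfrak S_n}t^{\operatorname{rdasc}(\pi)}\frac{x^n}{n!}=\frac{u\cosh(\frac12ux)+(1-t)\sinh(\frac12ux)}{u\cosh(\frac12ux)-(1+t)\sinh(\frac12ux)}$$ and $$\sum_{n\ge0}\sum_{\pi\in\mathfrak S_n}t^{\operatorname{lrdasc}(\pi)}\frac{x^n}{n!}=\frac{u\,e^{-\frac12(1-t)x}}{u\cosh(\frac12ux)-(1+t)\sinh(\frac12ux)}.$$
   Context: $\mathfrak S_n$ is the set of permutations of $[n]$. For $\pi=\pi_1\cdots\pi_n$: $i$ ($2\le i\le n-1$) is a double ascent if $\pi_{i-1}<\pi_i<\pi_{i+1}$; $i$ is a left double ascent if it is a double ascent or $i=1$ and $\pi_1<\pi_2$; $i$ is a right double ascent if it is a double ascent or $i=n$ and $\pi_{n-1}<\pi_n$; $i$ is a left-right double ascent if it is a left double ascent or a right double ascent, or if $\pi=1$ and $i=1$. Right-hand sides are formal power series in $x$ depending only on $u^2$. *)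

theory Defs
  imports
    "HOL-Combinatorics.Permutations"
    "HOL-Computational_Algebra.Formal_Power_Series"
begin

(* A permutation of [n] is a function p with p permutes {1..n}; its one-line notation is
   p 1, ..., p n.  Such a p fixes 0 and everything above n, so the range conditions on i and n
   below are essential: no comparison may involve p 0 or p (n + 1). *)

definition double_ascent :: "nat \<Rightarrow> (nat \<Rightarrow> nat) \<Rightarrow> nat \<Rightarrow> bool" where
  "double_ascent n p i \<longleftrightarrow> 2 \<le> i \<and> i + 1 \<le> n \<and> p (i - 1) < p i \<and> p i < p (i + 1)"

definition left_double_ascent :: "nat \<Rightarrow> (nat \<Rightarrow> nat) \<Rightarrow> nat \<Rightarrow> bool" where
  "left_double_ascent n p i \<longleftrightarrow> double_ascent n p i \<or> (i = 1 \<and> 2 \<le> n \<and> p 1 < p 2)"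

definition right_double_ascent :: "nat \<Rightarrow> (nat \<Rightarrow> nat) \<Rightarrow> nat \<Rightarrow> bool" where
  "right_double_ascent n p i \<longleftrightarrow> double_ascent n p i \<or> (i = n \<and> 2 \<le> n \<and> p (n - 1) < p n)"

(* The last disjunct is the case where the permutation is the one of length 1. *)
definition left_right_double_ascent :: "nat \<Rightarrow> (nat \<Rightarrow> nat) \<Rightarrow> nat \<Rightarrow> bool" where
  "left_right_double_ascent n p i \<longleftrightarrow>
     left_double_ascent n p i \<or> right_double_ascent n p i \<or> (n = 1 \<and> i = 1)"

definition rdasc :: "nat \<Rightarrow> (nat \<Rightarrow> nat) \<Rightarrow> nat" where
  "rdasc n p = card {i \<in> {1..n}. right_double_ascent n p i}"

definition lrdasc :: "nat \<Rightarrow> (nat \<Rightarrow> nat) \<Rightarrow> nat" where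
  "lrdasc n p = card {i \<in> {1..n}. left_right_double_ascent n p i}"

definition perm_egf :: "(nat \<Rightarrow> (nat \<Rightarrow> nat) \<Rightarrow> nat) \<Rightarrow> 'a \<Rightarrow> 'a::field_char_0 fps" where
  "perm_egf st t = Abs_fps (\<lambda>n. (\<Sum>p | p permutes {1..n}. t ^ st n p) / fact n)"

(* cosh (c x) and sinh (c x), as power series in x *)

definition fps_cosh :: "'a \<Rightarrow> 'a::field_char_0 fps" where
  "fps_cosh c = fps_const (1 / 2) * (fps_exp c + fps_exp (- c))"

definition fps_sinh :: "'a \<Rightarrow> 'a::field_char_0 fps" where
  "fps_sinh c = fps_const (1 / 2) * (fps_exp c - fps_exp (- c))"

(* For w = c^2 these are cosh (c x) and sinh (c x) / c.  They are defined for every w, including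
   w = 0 and non-squares, and express that u cosh (u x / 2) + a sinh (u x / 2), once divided
   by u, depends on u^2 only. *)

definition fps_cosh_sqrt :: "'a \<Rightarrow> 'a::field_char_0 fps" where
  "fps_cosh_sqrt w = Abs_fps (\<lambda>n. if even n then w ^ (n div 2) / fact n else 0)"

definition fps_sinhc_sqrt :: "'a \<Rightarrow> 'a::field_char_0 fps" where
  "fps_sinhc_sqrt w = Abs_fps (\<lambda>n. if odd n then w ^ (n div 2) / fact n else 0)"

lemma fps_cosh_sqrt_square: "fps_cosh_sqrt (c\<^sup>2) = fps_cosh c"
  by (rule fps_ext) (auto simp: fps_cosh_sqrt_def fps_cosh_def elim!: evenE simp flip: power_mult)

lemma fps_sinhc_sqrt_square: "fps_const c * fps_sinhc_sqrt (c\<^sup>2) = fps_sinh c"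
  by (rule fps_ext) (auto simp: fps_sinhc_sqrt_def fps_sinh_def elim!: oddE simp flip: power_mult)

end

theory Submission
  imports Defs "HOL-Combinatorics.Multiset_Permutations"
begin

text \<open>
  Splitting a permutation at its maximum gives the Riccati equation
  \<open>R' = R\<^sup>2 + (t - 1) (R - 1)\<close> for right double ascents and \<open>L' = L (R + t - 1)\<close> for left-right
  double ascents: the maximum itself is counted only if nothing follows it (and, for \<open>R\<close>, something
  precedes it). If \<open>N / D\<close> is the claimed closed form of \<open>R\<close> and \<open>b = (1 - t) / 2\<close>, then
  \<open>N' = 2 b D - b N\<close> and \<open>D' = b D - N\<close>, so that \<open>R D - N\<close> and \<open>L D - exp (- b x)\<close> have zero
  constant term and satisfy the homogeneous linear equations \<open>E' = (R - b) E\<close> and \<open>E' = - b E\<close>;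
  hence both vanish.
\<close>

unbundle fps_syntax

section \<open>Sums over subsets and over permutations written as lists\<close>

lemma sum_Pow_card:
  fixes f :: "nat \<Rightarrow> 'b::semiring_1"
  assumes "finite A"
  shows "(\<Sum>B\<in>Pow A. f (card B)) = (\<Sum>k\<le>card A. of_nat (card A choose k) * f k)"
proof -
  have "(\<Sum>B\<in>Pow A. f (card B)) = (\<Sum>k\<le>card A. \<Sum>B\<in>{B \<in> Pow A. card B = k}. f (card B))"
    using assms by (intro sum.group [symmetric]) (auto intro: card_mono)
  also have "\<dots> = (\<Sum>k\<le>card A. of_nat (card A choose k) * f k)"
    using assms by (intro sum.cong refl) (simp add: n_subsets)
  finally show ?thesis .
qed

text \<open>An arrangement containing \<open>m\<close> has the form \<open>ys @ m # zs\<close> in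
  exactly one way, so it corresponds to the set \<open>B\<close> of entries before \<open>m\<close>
  together with arrangements of \<open>B\<close> and of \<open>A - B\<close>.\<close>

lemma sum_permutations_of_set_insert:
  assumes "finite A" "m \<notin> A"
  shows "(\<Sum>xs\<in>permutations_of_set (insert m A). f xs) =
    (\<Sum>B\<in>Pow A. \<Sum>ys\<in>permutations_of_set B. \<Sum>zs\<in>permutations_of_set (A - B). f (ys @ m # zs))"
proof -
  have split: "takeWhile (\<lambda>x. x \<noteq> m) (ys @ m # zs) = ys"
      "dropWhile (\<lambda>x. x \<noteq> m) (ys @ m # zs) = m # zs" if "m \<notin> set ys" for ys zs
    using that by (induction ys) auto
  let ?S = "SIGMA B:Pow A. permutations_of_set B \<times> permutations_of_set (A - B)"
  have "(\<Sum>xs\<in>permutations_of_set (insert m A). f xs) = (\<Sum>(B, ys, zs)\<in>?S. f (ys @ m # zs))"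
  proof (rule sum.reindex_bij_witness [where
        i = "\<lambda>(B, ys, zs). ys @ m # zs" and
        j = "\<lambda>xs. (set (takeWhile (\<lambda>x. x \<noteq> m) xs), takeWhile (\<lambda>x. x \<noteq> m) xs,
                    tl (dropWhile (\<lambda>x. x \<noteq> m) xs))"], goal_cases)
    case (1 xs)
    then obtain ys zs where "xs = ys @ m # zs" "m \<notin> set ys"
      by (metis insertI1 permutations_of_setD(1) split_list_first)
    then show ?case by (simp add: split)
  next
    case (2 xs)
    then obtain ys zs where xs: "xs = ys @ m # zs" "m \<notin> set ys"
      by (metis insertI1 permutations_of_setD(1) split_list_first)
    moreover have "distinct xs" "set xs = insert m A"
      using 2 by (auto dest: permutations_of_setD)
    ultimately show ?case
      using assms(2) by (auto simp: permutations_of_set_def split)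
  next
    case (3 b)
    then obtain B ys zs where b: "b = (B, ys, zs)" "B \<subseteq> A" "set ys = B" "m \<notin> set ys"
      using assms(2) by (auto simp: permutations_of_set_def)
    then show ?case by (simp add: split)
  next
    case (4 b)
    then show ?case using assms(2) by (auto simp: permutations_of_set_def)
  next
    case (5 xs)
    then obtain ys zs where "xs = ys @ m # zs" "m \<notin> set ys"
      by (metis insertI1 permutations_of_setD(1) split_list_first)
    then show ?case by (simp add: split)
  qed
  also have "\<dots> = (\<Sum>B\<in>Pow A. \<Sum>ys\<in>permutations_of_set B. \<Sum>zs\<in>permutations_of_set (A - B). f (ys @ m # zs))"
    unfolding sum.cartesian_product using assms(1)
    by (subst sum.Sigma) (auto simp: split_def intro: finite_subset)
  finally show ?thesis .
qed

lemma sum_permutes_atLeastAtMost_1: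
  "(\<Sum>p | p permutes {1..n}. f (map p [1..<Suc n])) = (\<Sum>xs\<in>permutations_of_set {1..n}. f xs)"
proof (rule sum.reindex_bij_betw)
  show "bij_betw (\<lambda>p. map p [1..<Suc n]) {p. p permutes {1..n}} (permutations_of_set {1..n})"
    unfolding bij_betw_def
  proof
    show inj: "inj_on (\<lambda>p. map p [1..<Suc n]) {p. p permutes {1..n}}"
    proof (rule inj_onI, rule ext)
      fix p q x
      assume p: "p \<in> {p. p permutes {1..n}}" and q: "q \<in> {p. p permutes {1..n}}"
        and eq: "map p [1..<Suc n] = map q [1..<Suc n]"
      show "p x = q x"
      proof (cases "x \<in> {1..n}")
        case True
        then show ?thesis using eq by (auto simp del: upt_Suc)
      next
        case False
        then show ?thesis using p q by (simp add: permutes_not_in)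
      qed
    qed
    \<comment> \<open>Surjectivity comes from counting: both sets have \<open>fact n\<close>
      elements, so the inclusion is an equality.\<close>
    have "(\<lambda>p. map p [1..<Suc n]) ` {p. p permutes {1..n}} \<subseteq> permutations_of_set {1..n}"
    proof
      fix xs assume "xs \<in> (\<lambda>p. map p [1..<Suc n]) ` {p. p permutes {1..n}}"
      then obtain p where p: "p permutes {1..n}" "xs = map p [1..<Suc n]" by auto
      have "set xs = {1..n}"
        using permutes_image [OF p(1)] p(2) by (simp add: atLeastLessThanSuc_atLeastAtMost del: upt_Suc)
      moreover have "distinct xs"
        using p by (simp add: distinct_map permutes_inj_on del: upt_Suc)
      ultimately show "xs \<in> permutations_of_set {1..n}" by (simp add: permutations_of_set_def)
    qed
    then show "(\<lambda>p. map p [1..<Suc n]) ` {p. p permutes {1..n}} = permutations_of_set {1..n}"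
      by (rule card_subset_eq [rotated])
        (simp_all only: card_image [OF inj], simp_all add: card_permutations)
  qed
qed

section \<open>Double ascents counted along a list\<close>

text \<open>The list is followed by a virtual \<open>\<infinity>\<close>, and the flag says whether the step into its head
  is an ascent. So \<open>False\<close> amounts to a preceding virtual \<open>\<infinity>\<close> (right double ascents), and
  \<open>True\<close> to a preceding virtual \<open>0\<close> (left-right double ascents).\<close>

fun count_rdasc :: "bool \<Rightarrow> nat list \<Rightarrow> nat" where
  "count_rdasc l [] = 0"
| "count_rdasc l [x] = of_bool l"
| "count_rdasc l (x # y # ys) = of_bool (l \<and> x < y) + count_rdasc (x < y) (y # ys)"

text \<open>The last entry of \<open>ys\<close> is followed by the larger \<open>m\<close>, which
  acts like the virtual end, and \<open>zs\<close> is entered by a descent, so both parts count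
  independently. The entry \<open>m\<close> counts only if it is last and is entered by an ascent:
  from \<open>ys\<close>, or by the flag when \<open>ys\<close> is empty.\<close>

lemma count_rdasc_append_max:
  assumes "\<forall>x\<in>set ys. x < m" "\<forall>z\<in>set zs. z < m"
  shows "count_rdasc l (ys @ m # zs) =
    count_rdasc l ys + count_rdasc False zs + of_bool (zs = [] \<and> (l \<or> ys \<noteq> []))"
  using assms
proof (induction l ys rule: count_rdasc.induct)
  case (1 l)
  then show ?case by (cases zs) auto
next
  case (2 l x)
  then show ?case by (cases zs) auto
qed auto

lemma count_rdasc_eq_sum:
  "count_rdasc l xs = (\<Sum>i<length xs. of_bool ((if i = 0 then l else xs ! (i - 1) < xs ! i) \<and>
     (Suc i < length xs \<longrightarrow> xs ! i < xs ! Suc i)))"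
proof (induction l xs rule: count_rdasc.induct)
  case (3 l x y ys)
  have "count_rdasc l (x # y # ys) = of_bool (l \<and> x < y) + count_rdasc (x < y) (y # ys)"
    by simp
  \<comment> \<open>The flag \<open>x < y\<close> is the comparison into index 1 of the longer list,
    so the tail contributes the indices \<open>Suc i\<close> and only index 0 remains.\<close>
  also have "count_rdasc (x < y) (y # ys) = (\<Sum>i<length (y # ys).
      of_bool ((if Suc i = 0 then l else (x # y # ys) ! (Suc i - 1) < (x # y # ys) ! Suc i) \<and>
        (Suc (Suc i) < length (x # y # ys) \<longrightarrow> (x # y # ys) ! Suc i < (x # y # ys) ! Suc (Suc i))))"
    unfolding 3 by (intro sum.cong) (auto simp: nth_Cons')
  finally show ?case
    unfolding length_Cons [of x] sum.lessThan_Suc_shift by simp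
qed auto

lemma rdasc_eq_count_rdasc: "rdasc n p = count_rdasc False (map p [1..<Suc n])"
proof -
  have "rdasc n p = (\<Sum>i\<in>{1..n}. of_bool (right_double_ascent n p i))"
    by (simp add: rdasc_def Int_def)
  also have "\<dots> = (\<Sum>i<n. of_bool (right_double_ascent n p (Suc i)))"
    by (simp add: sum.atLeast1_atMost_eq)
  also have "\<dots> = count_rdasc False (map p [1..<Suc n])"
    unfolding count_rdasc_eq_sum
  proof (intro sum.cong)
    fix i assume "i \<in> {..<length (map p [1..<Suc n])}"
    then have "i < n" by (simp del: upt_Suc)
    \<comment> \<open>Index \<open>i\<close> of the list is position \<open>Suc i\<close>. The
      condition \<open>i \<noteq> 0\<close> excludes position 1 and keeps \<open>p 0\<close> out of
      every comparison.\<close>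
    then have "right_double_ascent n p (Suc i) \<longleftrightarrow>
        i \<noteq> 0 \<and> p i < p (Suc i) \<and> (Suc i < n \<longrightarrow> p (Suc i) < p (Suc (Suc i)))"
      by (cases "Suc i = n") (auto simp: right_double_ascent_def double_ascent_def)
    then show "of_bool (right_double_ascent n p (Suc i)) =
        (of_bool ((if i = 0 then False
           else map p [1..<Suc n] ! (i - 1) < map p [1..<Suc n] ! i) \<and>
         (Suc i < length (map p [1..<Suc n]) \<longrightarrow>
           map p [1..<Suc n] ! i < map p [1..<Suc n] ! Suc i)) :: nat)"
      using \<open>i < n\<close> by (simp del: upt_Suc)
  qed simp
  finally show ?thesis .
qed

lemma lrdasc_eq_count_rdasc: "lrdasc n p = count_rdasc True (map p [1..<Suc n])"
proof -
  have "lrdasc n p = (\<Sum>i\<in>{1..n}. of_bool (left_right_double_ascent n p i))"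
    by (simp add: lrdasc_def Int_def)
  also have "\<dots> = (\<Sum>i<n. of_bool (left_right_double_ascent n p (Suc i)))"
    by (simp add: sum.atLeast1_atMost_eq)
  also have "\<dots> = count_rdasc True (map p [1..<Suc n])"
    unfolding count_rdasc_eq_sum
  proof (intro sum.cong)
    fix i assume "i \<in> {..<length (map p [1..<Suc n])}"
    then have "i < n" by (simp del: upt_Suc)
    \<comment> \<open>For \<open>n = 1\<close> both implications are vacuous, which agrees with the
      convention that the permutation of length 1 counts its only entry.\<close>
    then have "left_right_double_ascent n p (Suc i) \<longleftrightarrow>
        (i \<noteq> 0 \<longrightarrow> p i < p (Suc i)) \<and> (Suc i < n \<longrightarrow> p (Suc i) < p (Suc (Suc i)))"
      by (cases "Suc i = n"; cases "i = 0")
        (auto simp: left_right_double_ascent_def left_double_ascent_def right_double_ascent_def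
          double_ascent_def numeral_2_eq_2)
    then show "of_bool (left_right_double_ascent n p (Suc i)) =
        (of_bool ((if i = 0 then True
           else map p [1..<Suc n] ! (i - 1) < map p [1..<Suc n] ! i) \<and>
         (Suc i < length (map p [1..<Suc n]) \<longrightarrow>
           map p [1..<Suc n] ! i < map p [1..<Suc n] ! Suc i)) :: nat)"
      using \<open>i < n\<close> by (simp del: upt_Suc)
  qed simp
  finally show ?thesis .
qed

section \<open>Splitting at the maximum: a binomial recurrence\<close>

text \<open>Arbitrary sets of naturals are allowed because splitting at the maximum leaves arbitrary
  subsets on its two sides.\<close>

definition rdasc_sum :: "'a::field_char_0 \<Rightarrow> bool \<Rightarrow> nat set \<Rightarrow> 'a" where
  "rdasc_sum t l A = (\<Sum>xs\<in>permutations_of_set A. t ^ count_rdasc l xs)"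

lemma rdasc_sum_empty [simp]: "rdasc_sum t l {} = 1"
  by (simp add: rdasc_sum_def)

text \<open>The maximum has weight \<open>t\<close> if nothing follows it and it is entered by an
  ascent, and weight 1 otherwise. Writing \<open>t\<close> as \<open>1 + (t - 1)\<close> gives the
  full sum over \<open>B\<close> plus a correction from \<open>B = A\<close>, where the right factor
  is 1.\<close>

lemma rdasc_sum_insert_max:
  assumes "finite A" "\<forall>a\<in>A. a < m"
  shows "rdasc_sum t l (insert m A) =
    (\<Sum>B\<in>Pow A. rdasc_sum t l B * rdasc_sum t False (A - B)) +
    of_bool (l \<or> A \<noteq> {}) * (t - 1) * rdasc_sum t l A"
proof -
  have "m \<notin> A" using assms(2) by blast
  have "rdasc_sum t l (insert m A) = (\<Sum>B\<in>Pow A. \<Sum>ys\<in>permutations_of_set B.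
      \<Sum>zs\<in>permutations_of_set (A - B). t ^ count_rdasc l (ys @ m # zs))"
    unfolding rdasc_sum_def by (rule sum_permutations_of_set_insert) fact+
  also have "\<dots> = (\<Sum>B\<in>Pow A. \<Sum>ys\<in>permutations_of_set B. \<Sum>zs\<in>permutations_of_set (A - B).
      t ^ count_rdasc l ys * t ^ count_rdasc False zs * (if B = A \<and> (l \<or> A \<noteq> {}) then t else 1))"
  proof (intro sum.cong refl)
    fix B ys zs
    assume "B \<in> Pow A" and ys: "ys \<in> permutations_of_set B" and zs: "zs \<in> permutations_of_set (A - B)"
    then have sets: "B \<subseteq> A" "set ys = B" "set zs = A - B"
      by (auto dest: permutations_of_setD)
    then have eq: "count_rdasc l (ys @ m # zs) =
        count_rdasc l ys + count_rdasc False zs + of_bool (zs = [] \<and> (l \<or> ys \<noteq> []))"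
      using assms(2) by (intro count_rdasc_append_max) auto
    have "zs = [] \<and> (l \<or> ys \<noteq> []) \<longleftrightarrow> B = A \<and> (l \<or> A \<noteq> {})"
      using sets by auto
    then show "t ^ count_rdasc l (ys @ m # zs) =
        t ^ count_rdasc l ys * t ^ count_rdasc False zs * (if B = A \<and> (l \<or> A \<noteq> {}) then t else 1)"
      unfolding eq by (auto simp: power_add)
  qed
  also have "\<dots> = (\<Sum>B\<in>Pow A. rdasc_sum t l B * rdasc_sum t False (A - B) *
      (if B = A \<and> (l \<or> A \<noteq> {}) then t else 1))"
    unfolding rdasc_sum_def sum_product by (simp only: sum_distrib_right)
  also have "\<dots> = (\<Sum>B\<in>Pow A. rdasc_sum t l B * rdasc_sum t False (A - B) +
      (if B = A then of_bool (l \<or> A \<noteq> {}) * (t - 1) * rdasc_sum t l A else 0))"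
    by (intro sum.cong) (auto simp: algebra_simps)
  also have "\<dots> = (\<Sum>B\<in>Pow A. rdasc_sum t l B * rdasc_sum t False (A - B)) +
      of_bool (l \<or> A \<noteq> {}) * (t - 1) * rdasc_sum t l A"
    using assms(1) by (simp add: sum.distrib)
  finally show ?thesis .
qed

text \<open>Dependence on cardinality alone is a premise, so that the formula can serve inside the
  induction that proves this dependence and again afterwards as the recurrence.\<close>

lemma rdasc_sum_insert_max_card:
  assumes "finite A" "\<forall>a\<in>A. a < m"
    and card: "\<And>l B. B \<subseteq> A \<Longrightarrow> rdasc_sum t l B = rdasc_sum t l {1..card B}"
  shows "rdasc_sum t l (insert m A) =
    (\<Sum>k\<le>card A. of_nat (card A choose k) *
       (rdasc_sum t l {1..k} * rdasc_sum t False {1..card A - k})) +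
    of_bool (l \<or> card A \<noteq> 0) * (t - 1) * rdasc_sum t l {1..card A}"
proof -
  have "(\<Sum>B\<in>Pow A. rdasc_sum t l B * rdasc_sum t False (A - B)) =
      (\<Sum>B\<in>Pow A. rdasc_sum t l {1..card B} * rdasc_sum t False {1..card A - card B})"
  proof (intro sum.cong refl)
    fix B assume "B \<in> Pow A"
    then have "B \<subseteq> A" by simp
    moreover from this have "card (A - B) = card A - card B"
      using assms(1) by (intro card_Diff_subset finite_subset [of B A])
    ultimately show "rdasc_sum t l B * rdasc_sum t False (A - B) =
        rdasc_sum t l {1..card B} * rdasc_sum t False {1..card A - card B}"
      using card [of B l] card [of "A - B" False] by simp
  qed
  also have "\<dots> = (\<Sum>k\<le>card A. of_nat (card A choose k) *
       (rdasc_sum t l {1..k} * rdasc_sum t False {1..card A - k}))"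
    by (rule sum_Pow_card) fact
  finally show ?thesis
    unfolding rdasc_sum_insert_max [OF assms(1,2)] using card [of A l] assms(1) by simp
qed

text \<open>Strong induction on the size: removing the maximum from \<open>A\<close> and from
  \<open>{1..card A}\<close> leaves sets of equal size, and the right-hand side of the recurrence
  depends only on that size.\<close>

lemma rdasc_sum_card:
  assumes "finite A"
  shows "rdasc_sum t l A = rdasc_sum t l {1..card A}"
  using assms
proof (induction "card A" arbitrary: A l rule: less_induct)
  case less
  show ?case
  proof (cases "A = {}")
    case False
    have smaller: "rdasc_sum t l' B = rdasc_sum t l' {1..card B}"
      if "finite B" "card B < card A" for l' B
      using less.hyps [OF that(2,1)] .
    have step: "rdasc_sum t l (insert m C) =
        (\<Sum>k\<le>card C. of_nat (card C choose k) *
           (rdasc_sum t l {1..k} * rdasc_sum t False {1..card C - k})) +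
        of_bool (l \<or> card C \<noteq> 0) * (t - 1) * rdasc_sum t l {1..card C}"
      if "finite C" "card C < card A" "\<forall>c\<in>C. c < m" for C m
      using that(1)
    proof (rule rdasc_sum_insert_max_card)
      fix l' B assume "B \<subseteq> C"
      then show "rdasc_sum t l' B = rdasc_sum t l' {1..card B}"
        using that by (intro smaller finite_subset [of B C] le_less_trans [OF card_mono [of C B]])
    qed fact
    obtain n where n: "card A = Suc n"
      using False less.prems by (metis card_eq_0_iff not0_implies_Suc)
    define C where "C = A - {Max A}"
    have "Max A \<in> A" using less.prems False by (rule Max_in)
    then have C: "finite C" "card C = n" "A = insert (Max A) C"
      using less.prems n unfolding C_def by auto
    have C_less: "\<forall>c\<in>C. c < Max A"
      using Max_ge [OF less.prems] unfolding C_def by (auto simp: order.strict_iff_order)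
    have "rdasc_sum t l (insert (Max A) C) = rdasc_sum t l (insert (Suc n) {1..n})"
      using step [of C "Max A"] step [of "{1..n}" "Suc n"] C(1,2) C_less n by simp
    also have "insert (Suc n) {1..n} = {1..Suc n}" by (simp add: atLeastAtMostSuc_conv)
    finally show ?thesis unfolding n C(3) [symmetric] .
  qed simp
qed

lemma rdasc_sum_Suc:
  "rdasc_sum t l {1..Suc n} =
    (\<Sum>k\<le>n. of_nat (n choose k) * (rdasc_sum t l {1..k} * rdasc_sum t False {1..n - k})) +
    of_bool (l \<or> n \<noteq> 0) * (t - 1) * rdasc_sum t l {1..n}"
proof -
  have "rdasc_sum t l (insert (Suc n) {1..n}) =
    (\<Sum>k\<le>card {1..n}. of_nat (card {1..n} choose k) *
       (rdasc_sum t l {1..k} * rdasc_sum t False {1..card {1..n} - k})) +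
    of_bool (l \<or> card {1..n} \<noteq> 0) * (t - 1) * rdasc_sum t l {1..card {1..n}}"
    by (intro rdasc_sum_insert_max_card rdasc_sum_card) (auto dest: finite_subset)
  then show ?thesis
    by (simp only: atLeastAtMostSuc_conv card_atLeastAtMost le_add2 plus_1_eq_Suc diff_Suc_1
        not_False_eq_True)
qed

section \<open>Generating functions and their differential equations\<close>

definition rdasc_egf :: "'a::field_char_0 \<Rightarrow> bool \<Rightarrow> 'a fps" where
  "rdasc_egf t l = Abs_fps (\<lambda>n. rdasc_sum t l {1..n} / fact n)"

lemma perm_egf_rdasc: "perm_egf rdasc t = rdasc_egf t False"
  unfolding perm_egf_def rdasc_egf_def rdasc_sum_def rdasc_eq_count_rdasc
  by (simp only: sum_permutes_atLeastAtMost_1 [of "\<lambda>xs. t ^ count_rdasc False xs"])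

lemma perm_egf_lrdasc: "perm_egf lrdasc t = rdasc_egf t True"
  unfolding perm_egf_def rdasc_egf_def rdasc_sum_def lrdasc_eq_count_rdasc
  by (simp only: sum_permutes_atLeastAtMost_1 [of "\<lambda>xs. t ^ count_rdasc True xs"])

lemma rdasc_egf_nth_0 [simp]: "rdasc_egf t l $ 0 = 1"
  by (simp add: rdasc_egf_def)

text \<open>The flag \<open>False\<close> gives the Riccati equation and \<open>True\<close> the
  linear one. The recurrence lacks its correction term only for \<open>n = 0\<close> and
  \<open>l = False\<close>; subtracting the constant term 1 has the same effect.\<close>

lemma fps_deriv_rdasc_egf:
  "fps_deriv (rdasc_egf t l) =
    rdasc_egf t l * rdasc_egf t False + fps_const (t - 1) * (rdasc_egf t l - of_bool (\<not> l))"
proof (rule fps_ext)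
  fix n
  have "fps_deriv (rdasc_egf t l) $ n = rdasc_sum t l {1..Suc n} / fact n"
    by (simp add: rdasc_egf_def field_simps del: of_nat_Suc)
  \<comment> \<open>Division by \<open>fact n\<close> turns the binomial convolution into a Cauchy
    product.\<close>
  also have "\<dots> = (\<Sum>k\<le>n. (rdasc_sum t l {1..k} / fact k) * (rdasc_sum t False {1..n - k} / fact (n - k))) +
      of_bool (l \<or> n \<noteq> 0) * (t - 1) * (rdasc_sum t l {1..n} / fact n)"
    unfolding rdasc_sum_Suc add_divide_distrib sum_divide_distrib
    by (intro arg_cong2 [where f = "(+)"] sum.cong) (simp_all add: binomial_fact)
  also have "\<dots> = (rdasc_egf t l * rdasc_egf t False +
      fps_const (t - 1) * (rdasc_egf t l - of_bool (\<not> l))) $ n"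
    unfolding fps_add_nth fps_mult_left_const_nth fps_mult_nth [of "rdasc_egf t l"]
    by (cases "n = 0"; cases l) (simp_all add: rdasc_egf_def atLeast0AtMost)
  finally show "fps_deriv (rdasc_egf t l) $ n = (rdasc_egf t l * rdasc_egf t False +
      fps_const (t - 1) * (rdasc_egf t l - of_bool (\<not> l))) $ n" .
qed

section \<open>Linear differential equations and the closed forms\<close>

text \<open>Coefficient \<open>k\<close> of the equation expresses
  \<open>of_nat (Suc k) * E $ Suc k\<close> through \<open>E $ 0\<close>, ..., \<open>E $ k\<close>,
  and \<open>of_nat (Suc k)\<close> is invertible in characteristic 0.\<close>

lemma fps_linear_ode_unique_0:
  fixes E :: "'a::field_char_0 fps"
  assumes "fps_deriv E = G * E" "E $ 0 = 0"
  shows "E = 0"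
proof -
  have "E $ n = 0" for n
  proof (induction n rule: less_induct)
    case (less n)
    show ?case
    proof (cases n)
      case (Suc k)
      have "of_nat (Suc k) * E $ Suc k = (G * E) $ k"
        unfolding assms(1) [symmetric] by simp
      also have "\<dots> = 0"
        using less Suc by (simp add: fps_mult_nth)
      finally show ?thesis using Suc by (simp del: of_nat_Suc)
    qed (simp add: assms)
  qed
  then show ?thesis by (simp add: fps_eq_iff)
qed

lemma fps_deriv_cosh_sqrt: "fps_deriv (fps_cosh_sqrt w) = fps_const w * fps_sinhc_sqrt w"
  by (rule fps_ext)
    (auto simp: fps_cosh_sqrt_def fps_sinhc_sqrt_def field_simps elim!: oddE simp del: of_nat_Suc)

lemma fps_deriv_sinhc_sqrt: "fps_deriv (fps_sinhc_sqrt w) = fps_cosh_sqrt w"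
  by (rule fps_ext)
    (auto simp: fps_cosh_sqrt_def fps_sinhc_sqrt_def field_simps elim!: evenE simp del: of_nat_Suc)

text \<open>\<open>N\<close> and \<open>D\<close> are the numerator and denominator of the first
  closed form divided by \<open>u\<close>. The argument \<open>w / 4\<close> is the square of
  \<open>u / 2\<close>, and sinh (u x / 2) / u is half of \<open>fps_sinhc_sqrt (w / 4)\<close>,
  whence the halved coefficients.\<close>

context
  fixes t w :: "'a::field_char_0" and N D :: "'a fps"
  assumes w: "w = (t + 3) * (t - 1)"
  defines "N \<equiv> fps_cosh_sqrt (w / 4) + fps_const ((1 - t) / 2) * fps_sinhc_sqrt (w / 4)"
    and "D \<equiv> fps_cosh_sqrt (w / 4) - fps_const ((1 + t) / 2) * fps_sinhc_sqrt (w / 4)"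
begin

lemma rdasc_numerator_nth_0: "N $ 0 = 1" and rdasc_denominator_nth_0: "D $ 0 = 1"
  by (simp_all add: N_def D_def fps_cosh_sqrt_def fps_sinhc_sqrt_def)

text \<open>The choice of \<open>w\<close> enters here: the coefficient of
  \<open>fps_sinhc_sqrt (w / 4)\<close> on the right is \<open>(t + 3) * (t - 1) / 4\<close>, which
  is \<open>w / 4\<close>.\<close>

lemma fps_deriv_rdasc_numerator:
  "fps_deriv N = fps_const (1 - t) * D - fps_const ((1 - t) / 2) * N"
  by (rule fps_ext) (simp add: N_def D_def fps_deriv_cosh_sqrt fps_deriv_sinhc_sqrt w field_simps
      del: fps_deriv_nth)

lemma fps_deriv_rdasc_denominator: "fps_deriv D = fps_const ((1 - t) / 2) * D - N"
  by (rule fps_ext) (simp add: N_def D_def fps_deriv_cosh_sqrt fps_deriv_sinhc_sqrt w field_simps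
      del: fps_deriv_nth)

lemma rdasc_egf_mult_denominator: "rdasc_egf t False * D = N"
proof -
  have "rdasc_egf t False * D - N = 0"
  proof (rule fps_linear_ode_unique_0)
    show "fps_deriv (rdasc_egf t False * D - N) =
        (rdasc_egf t False - fps_const ((1 - t) / 2)) * (rdasc_egf t False * D - N)"
    proof -
      \<comment> \<open>With all constants expressed through the single series
        \<open>fps_const ((1 - t) / 2)\<close>, the claim is a polynomial identity.\<close>
      have c: "fps_const (t - 1) = - 2 * fps_const ((1 - t) / 2)"
        "fps_const (1 - t) = 2 * fps_const ((1 - t) / 2)"
        by (simp_all add: fps_eq_iff fps_numeral_nth numeral_fps_const)
      show ?thesis
        by (simp add: fps_deriv_rdasc_egf fps_deriv_rdasc_numerator fps_deriv_rdasc_denominator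
            del: fps_const_sub) (simp only: c, algebra)
    qed
  qed (simp add: rdasc_numerator_nth_0 rdasc_denominator_nth_0)
  then show ?thesis by simp
qed

lemma lrdasc_egf_mult_denominator: "rdasc_egf t True * D = fps_exp (- (1 / 2) * (1 - t))"
proof -
  have "rdasc_egf t True * D - fps_exp (- (1 / 2) * (1 - t)) = 0"
  proof (rule fps_linear_ode_unique_0)
    show "fps_deriv (rdasc_egf t True * D - fps_exp (- (1 / 2) * (1 - t))) =
        - fps_const ((1 - t) / 2) * (rdasc_egf t True * D - fps_exp (- (1 / 2) * (1 - t)))"
    proof -
      have c: "fps_const (t - 1) = - 2 * fps_const ((1 - t) / 2)"
        "fps_const (- (1 / 2) * (1 - t)) = - fps_const ((1 - t) / 2)"
        by (simp_all add: fps_eq_iff fps_numeral_nth numeral_fps_const)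
      have "fps_deriv (rdasc_egf t True * D - fps_exp (- (1 / 2) * (1 - t))) =
        (rdasc_egf t True * rdasc_egf t False + fps_const (t - 1) * rdasc_egf t True) * D +
        rdasc_egf t True * (fps_const ((1 - t) / 2) * D - N) -
        fps_const (- (1 / 2) * (1 - t)) * fps_exp (- (1 / 2) * (1 - t))"
        unfolding fps_deriv_sub fps_deriv_mult fps_deriv_rdasc_egf fps_deriv_rdasc_denominator
           fps_exp_deriv by simp
      then show ?thesis
        \<comment> \<open>The closed form of the other series makes the terms
          \<open>rdasc_egf t True * rdasc_egf t False * D\<close> and
          \<open>rdasc_egf t True * N\<close> cancel.\<close>
        unfolding c using rdasc_egf_mult_denominator by algebra
    qed
  qed (simp add: rdasc_denominator_nth_0)
  then show ?thesis by simp
qed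

end

section \<open>Quotients, with and without a square root of \<open>w\<close>\<close>

lemma fps_divide_eqI:
  fixes X Y Z :: "'a::field fps"
  assumes "X * Y = Z" "Y \<noteq> 0"
  shows "X = Z / Y"
  using assms by auto

text \<open>The formulas in \<open>u\<close> require a nonzero square root of \<open>w\<close> in
  the field; those in \<open>w / 4\<close> also cover \<open>t = 1\<close>, \<open>t = - 3\<close>
  and non-square \<open>w\<close>.\<close>

theorem theorem13:
  fixes t w :: "'a::field_char_0"
  assumes "w = (t + 3) * (t - 1)"
  shows
    "(\<forall>u. u\<^sup>2 = w \<and> u \<noteq> 0 \<longrightarrow>
        perm_egf rdasc t =
          (fps_const u * fps_cosh (u / 2) + fps_const (1 - t) * fps_sinh (u / 2)) /
          (fps_const u * fps_cosh (u / 2) - fps_const (1 + t) * fps_sinh (u / 2))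
        \<and>
        perm_egf lrdasc t =
          (fps_const u * fps_exp (- (1 / 2) * (1 - t))) /
          (fps_const u * fps_cosh (u / 2) - fps_const (1 + t) * fps_sinh (u / 2)))
     \<and>
     perm_egf rdasc t =
       (fps_cosh_sqrt (w / 4) + fps_const ((1 - t) / 2) * fps_sinhc_sqrt (w / 4)) /
       (fps_cosh_sqrt (w / 4) - fps_const ((1 + t) / 2) * fps_sinhc_sqrt (w / 4))
     \<and>
     perm_egf lrdasc t =
       fps_exp (- (1 / 2) * (1 - t)) /
       (fps_cosh_sqrt (w / 4) - fps_const ((1 + t) / 2) * fps_sinhc_sqrt (w / 4))"
proof -
  define N where "N = fps_cosh_sqrt (w / 4) + fps_const ((1 - t) / 2) * fps_sinhc_sqrt (w / 4)"
  define D where "D = fps_cosh_sqrt (w / 4) - fps_const ((1 + t) / 2) * fps_sinhc_sqrt (w / 4)"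
  have D: "D \<noteq> 0"
    using rdasc_denominator_nth_0 [OF assms] by (auto simp: D_def)
  have R: "perm_egf rdasc t * D = N"
    unfolding perm_egf_rdasc N_def D_def by (rule rdasc_egf_mult_denominator) fact
  have L: "perm_egf lrdasc t * D = fps_exp (- (1 / 2) * (1 - t))"
    unfolding perm_egf_lrdasc D_def by (rule lrdasc_egf_mult_denominator) fact
  have u: "perm_egf rdasc t =
          (fps_const u * fps_cosh (u / 2) + fps_const (1 - t) * fps_sinh (u / 2)) /
          (fps_const u * fps_cosh (u / 2) - fps_const (1 + t) * fps_sinh (u / 2))
        \<and>
        perm_egf lrdasc t =
          (fps_const u * fps_exp (- (1 / 2) * (1 - t))) /
          (fps_const u * fps_cosh (u / 2) - fps_const (1 + t) * fps_sinh (u / 2))"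
    if "u\<^sup>2 = w" "u \<noteq> 0" for u
  proof -
    have w4: "w / 4 = (u / 2)\<^sup>2" using that by (simp add: power_divide)
    \<comment> \<open>Since \<open>fps_sinh (u / 2)\<close> is
      \<open>fps_const (u / 2) * fps_sinhc_sqrt (w / 4)\<close>, a common factor \<open>u\<close>
      splits off numerator and denominator.\<close>
    have Nu: "fps_const u * fps_cosh (u / 2) + fps_const (1 - t) * fps_sinh (u / 2) = fps_const u * N"
      unfolding N_def w4 fps_cosh_sqrt_square fps_sinhc_sqrt_square [symmetric]
      by (rule fps_ext) (simp add: field_simps)
    have Du: "fps_const u * fps_cosh (u / 2) - fps_const (1 + t) * fps_sinh (u / 2) = fps_const u * D"
      unfolding D_def w4 fps_cosh_sqrt_square fps_sinhc_sqrt_square [symmetric]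
      by (rule fps_ext) (simp add: field_simps)
    have "fps_const u * D \<noteq> 0" using D that by simp
    then show ?thesis
      unfolding Nu Du using R L
      by (intro conjI fps_divide_eqI) (auto simp: algebra_simps)
  qed
  show ?thesis
    using u fps_divide_eqI [OF R D] fps_divide_eqI [OF L D] unfolding N_def D_def by blast
qed

end
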